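(* Let $S$ be a join semilattice with operation $\odot$, let $t$ and $s$ be a pair of elements of $S$, and let $\Theta_{t \odot s, s}$ be the principal congruence of $S$ that equates $t \odot s$ and $s$. Then $$\Theta_{t \odot s, s} = \{ (a,a) : a \in S \} \cup \{ (a,b) : a, b \in S,\ s \le a,\ s \le b \text{ and } t \odot a = b \odot t \}.$$
   Context: A join semilattice is a set $S$ with an associative, commutative and idempotent binary operation $\odot$, ordered by $a \le b$ if and only if $a \odot b = b$. A congruence of $S$ is an equivalence relation on $S$ (viewed as a subset of $S \times S$) compatible with $\odot$. $\Theta_{t \odot s, s}$ is the smallest congruence of $S$ containing the pair $(t \odot s, s)$. *)

theory Defs
  imports Main
begin

text \<open>The semilattice lives on an explicit carrier, since the classes and locales
  for semilattices in Main only cover operations on a whole type.\<close>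

locale join_semilattice =
  fixes S :: "'a set" and join :: "'a \<Rightarrow> 'a \<Rightarrow> 'a"
  assumes closed: "a \<in> S \<Longrightarrow> b \<in> S \<Longrightarrow> join a b \<in> S"
    and assoc: "a \<in> S \<Longrightarrow> b \<in> S \<Longrightarrow> c \<in> S \<Longrightarrow> join (join a b) c = join a (join b c)"
    and commute: "a \<in> S \<Longrightarrow> b \<in> S \<Longrightarrow> join a b = join b a"
    and idem: "a \<in> S \<Longrightarrow> join a a = a"

definition join_le :: "('a \<Rightarrow> 'a \<Rightarrow> 'a) \<Rightarrow> 'a \<Rightarrow> 'a \<Rightarrow> bool"
  where "join_le join a b \<longleftrightarrow> join a b = b"

definition congruence :: "'a set \<Rightarrow> ('a \<Rightarrow> 'a \<Rightarrow> 'a) \<Rightarrow> ('a \<times> 'a) set \<Rightarrow> bool"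
  where "congruence S join \<theta> \<longleftrightarrow>
    equiv S \<theta> \<and>
    (\<forall>a b c d. (a, b) \<in> \<theta> \<longrightarrow> (c, d) \<in> \<theta> \<longrightarrow> (join a c, join b d) \<in> \<theta>)"

definition principal_congruence ::
    "'a set \<Rightarrow> ('a \<Rightarrow> 'a \<Rightarrow> 'a) \<Rightarrow> 'a \<Rightarrow> 'a \<Rightarrow> ('a \<times> 'a) set"
  where "principal_congruence S join x y = \<Inter> {\<theta>. congruence S join \<theta> \<and> (x, y) \<in> \<theta>}"

text \<open>The intersection is the smallest congruence containing the pair; in particular
  the family being intersected is nonempty.\<close>

lemma (in join_semilattice) congruence_total: "congruence S join (S \<times> S)"
  unfolding congruence_def equiv_def refl_on_def sym_def trans_def using closed by blast

lemma (in join_semilattice) principal_congruence_least: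
  assumes "x \<in> S" and "y \<in> S"
  shows "congruence S join (principal_congruence S join x y)"
    and "(x, y) \<in> principal_congruence S join x y"
    and "\<And>\<theta>. congruence S join \<theta> \<Longrightarrow> (x, y) \<in> \<theta> \<Longrightarrow> principal_congruence S join x y \<subseteq> \<theta>"
proof -
  let ?P = "principal_congruence S join x y"
  have mem: "p \<in> ?P \<longleftrightarrow> (\<forall>\<theta>. congruence S join \<theta> \<longrightarrow> (x, y) \<in> \<theta> \<longrightarrow> p \<in> \<theta>)" for p
    by (auto simp: principal_congruence_def)
  have sub: "?P \<subseteq> S \<times> S"
    using congruence_total assms by (auto simp: mem)
  have "refl_on S ?P"
    by (rule refl_onI) (simp add: mem congruence_def equiv_def refl_on_def)
  moreover have "sym ?P"
    by (rule symI) (meson mem congruence_def equiv_def symD)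
  moreover have "trans ?P"
    by (rule transI) (meson mem congruence_def equiv_def transD)
  ultimately have "equiv S ?P"
    using sub by (intro equivI)
  moreover have "(join a c, join b d) \<in> ?P" if "(a, b) \<in> ?P" "(c, d) \<in> ?P" for a b c d
    using that unfolding mem by (meson congruence_def)
  ultimately show "congruence S join ?P"
    unfolding congruence_def[of S join ?P] by blast
  show "(x, y) \<in> ?P" by (simp add: mem)
  show "congruence S join \<theta> \<Longrightarrow> (x, y) \<in> \<theta> \<Longrightarrow> ?P \<subseteq> \<theta>" for \<theta>
    by (auto simp: mem)
qed

end

theory Submission
  imports Defs
begin

text \<open>The right-hand side is a congruence containing the pair. Conversely, a congruence
  \<open>\<theta>\<close> containing \<open>(t \<odot> s, s)\<close> relates \<open>t \<odot> a\<close> to \<open>a\<close> for every \<open>a \<ge> s\<close> (join both sides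
  with \<open>a\<close>), so \<open>t \<odot> a = t \<odot> b\<close> forces \<open>a\<close>, \<open>b\<close> to be related through that common element.\<close>

context join_semilattice
begin

lemma left_commute:
  assumes "a \<in> S" "b \<in> S" "c \<in> S"
  shows "join a (join b c) = join b (join a c)"
  using assms by (metis assoc commute)

lemma join_le_joinI:
  assumes "s \<in> S" "a \<in> S" "b \<in> S" "join_le join s a"
  shows "join_le join s (join a b)"
  using assms by (metis assoc join_le_def)

text \<open>On the up-set of \<open>s\<close> the relation is the kernel of the homomorphism
  \<open>join t\<close>, and the diagonal extends it to all of \<open>S\<close>. Joining with any
  element of \<open>S\<close> stays inside that up-set, so compatibility survives the
  extension.\<close>

lemma congruence_same_join_above:
  assumes t: "t \<in> S" and s: "s \<in> S"
  shows "congruence S join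
    ({(a, a) | a. a \<in> S} \<union>
     {(a, b) | a b. a \<in> S \<and> b \<in> S \<and> join_le join s a \<and> join_le join s b \<and>
       join t a = join b t})"
    (is "congruence S join ?R")
proof -
  \<comment> \<open>With \<open>join b t\<close> commuted to \<open>join t b\<close> the condition
    has the symmetric shape of a kernel, so symmetry and transitivity are immediate.\<close>
  have mem: "(a, b) \<in> ?R \<longleftrightarrow> a \<in> S \<and> b \<in> S \<and>
      (a = b \<or> join_le join s a \<and> join_le join s b \<and> join t a = join t b)" for a b
    using commute t by auto
  have "trans ?R"
    by (rule transI) (unfold mem, auto)
  have "equiv S ?R"
  proof (rule equivI)
    show "?R \<subseteq> S \<times> S" by auto
    show "refl_on S ?R" by (auto intro: refl_onI)
    show "sym ?R" by (rule symI) (unfold mem, auto)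
  qed fact
  have right: "(join a c, join b c) \<in> ?R" if "(a, b) \<in> ?R" "c \<in> S" for a b c
  proof -
    have "join t (join a c) = join t (join b c)"
      using that t unfolding mem by (metis assoc)
    with that show ?thesis
      unfolding mem using s by (auto simp: closed join_le_joinI)
  qed
  have comp: "(join a c, join b d) \<in> ?R" if "(a, b) \<in> ?R" "(c, d) \<in> ?R" for a b c d
  proof -
    have S: "a \<in> S" "b \<in> S" "c \<in> S" "d \<in> S"
      using that unfolding mem by auto
    \<comment> \<open>The two pairs are to be chained through \<open>join b c\<close>. The second
      one starts with its joins swapped, since \<open>right\<close> varies only the left
      argument.\<close>
    have "(join a c, join b c) \<in> ?R" "(join c b, join d b) \<in> ?R"
      using right that S by blast+
    then have "(join a c, join b c) \<in> ?R" "(join b c, join b d) \<in> ?R"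
      using S by (simp_all only: commute)
    with \<open>trans ?R\<close> show ?thesis
      by (rule transD)
  qed
  show ?thesis
    unfolding congruence_def using \<open>equiv S ?R\<close> comp by blast
qed

lemma congruence_join_above:
  assumes \<theta>: "congruence S join \<theta>" and ts: "(join t s, s) \<in> \<theta>"
    and S: "t \<in> S" "s \<in> S" "a \<in> S" and "join_le join s a"
  shows "(join t a, a) \<in> \<theta>"
proof -
  have "(a, a) \<in> \<theta>"
    using \<theta> \<open>a \<in> S\<close> by (auto simp: congruence_def equiv_def refl_on_def)
  \<comment> \<open>As \<open>s\<close> lies below \<open>a\<close>, \<open>join s a\<close>
    collapses to \<open>a\<close> in both entries, after reassociating the first.\<close>
  then have "(join (join t s) a, join s a) \<in> \<theta>"
    using \<theta> ts by (auto simp: congruence_def)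
  with assms show ?thesis
    by (simp add: assoc join_le_def)
qed

end

theorem theorem4p1:
  fixes S :: "'a set" and join :: "'a \<Rightarrow> 'a \<Rightarrow> 'a" (infixl "\<odot>" 70) and t s :: 'a
  assumes "join_semilattice S (\<odot>)" and "t \<in> S" and "s \<in> S"
  shows "principal_congruence S (\<odot>) (t \<odot> s) s =
    {(a, a) | a. a \<in> S} \<union>
    {(a, b) | a b. a \<in> S \<and> b \<in> S \<and> join_le (\<odot>) s a \<and> join_le (\<odot>) s b \<and> t \<odot> a = b \<odot> t}"
    (is "?P = ?R")
proof -
  interpret join_semilattice S "(\<odot>)" by fact
  have ts: "t \<odot> s \<in> S"
    using assms closed by blast
  show ?thesis
  proof
    \<comment> \<open>The generating pair belongs to the second set: both entries lie above
      \<open>s\<close>, and by idempotence joining \<open>t\<close> once more to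
      \<open>t \<odot> s\<close> changes nothing.\<close>
    have "join_le (\<odot>) s (t \<odot> s)" "join_le (\<odot>) s s"
      using assms left_commute[of s t s] by (simp_all add: join_le_def idem)
    moreover have "t \<odot> (t \<odot> s) = s \<odot> t"
      using assms assoc[of t t s] commute[of t s] idem[of t] by simp
    ultimately have "(t \<odot> s, s) \<in> ?R"
      using ts assms(3) by simp
    then show "?P \<subseteq> ?R"
      by (rule principal_congruence_least(3)[OF ts assms(3) congruence_same_join_above[OF assms(2,3)]])
  next
    have P: "congruence S (\<odot>) ?P" "(t \<odot> s, s) \<in> ?P"
      by (fact principal_congruence_least[OF ts assms(3)])+
    then have eq: "refl_on S ?P" "sym ?P" "trans ?P"
      unfolding congruence_def equiv_def by simp_all
    have "(a, b) \<in> ?P"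
      if "a \<in> S" "b \<in> S" "join_le (\<odot>) s a" "join_le (\<odot>) s b" "t \<odot> a = b \<odot> t" for a b
    proof -
      have "(t \<odot> a, a) \<in> ?P" and b: "(t \<odot> b, b) \<in> ?P"
        using congruence_join_above[OF P assms(2,3)] that(1-4) by simp_all
      moreover have "t \<odot> a = t \<odot> b"
        using that(5) commute[OF that(2) assms(2)] by simp
      ultimately have "(a, t \<odot> b) \<in> ?P"
        using symD[OF eq(2)] by simp
      then show ?thesis
        using b by (rule transD[OF eq(3)])
    qed
    then show "?R \<subseteq> ?P"
      using refl_onD[OF eq(1)] by blast
  qed
qed

end
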